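(* There is an absolute constant $C>0$ such that the following holds. Let $A\in\mathbb{R}^{m\times n}$ with $\operatorname{rk}(A)=m$, $b\in\mathbb{R}^m$, and $P=\{x\in\mathbb{R}^n: Ax=b,\ x\ge \mathbb{0}\}$. Then the circuit diameter of $P$ is at most $C\, m\min\{m,n-m\}\log(m+\kappa_A)$.
   Context: For $W=\ker(A)$, an elementary vector is a nonzero $g\in W$ whose support is minimal, i.e. there is no $h\in W\setminus\{\mathbb{0}\}$ with $\mathrm{supp}(h)\subsetneq\mathrm{supp}(g)$; $\mathcal E(A)$ denotes the set of elementary vectors. The circuit imbalance measure is $\kappa_A=\max\{|g_i|/|g_j| : g\in\mathcal E(A),\ i,j\in\mathrm{supp}(g)\}$. A circuit walk in $P$ is a sequence $x^{(1)},\dots,x^{(k+1)}\in P$ such that for each $i$, $x^{(i+1)}=x^{(i)}+g^{(i)}$ with $g^{(i)}\in\mathcal E(A)$ and $x^{(i)}+(1+\varepsilon)g^{(i)}\notin P$ for every $\varepsilon>0$ (each step is maximal); its length is $k$. The circuit diameter of $P$ is the maximum, over all ordered pairs of vertices $x,y$ of $P$, of the minimum length of a circuit walk from $x$ to $y$. *)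

theory Defs
  imports "HOL-Analysis.Analysis"
begin

text \<open>Matrices A in R^(m x n) are functions nat => nat => real, used only on
  indices i < m, j < n. Vectors in R^n are functions nat => real that vanish
  outside {..<n}.\<close>

definition rvec :: "nat \<Rightarrow> (nat \<Rightarrow> real) \<Rightarrow> bool" where
  "rvec n x \<longleftrightarrow> (\<forall>j\<ge>n. x j = 0)"

definition matvec :: "nat \<Rightarrow> (nat \<Rightarrow> nat \<Rightarrow> real) \<Rightarrow> (nat \<Rightarrow> real) \<Rightarrow> nat \<Rightarrow> real" where
  "matvec n A x = (\<lambda>i. \<Sum>j<n. A i j * x j)"

definition full_row_rank :: "nat \<Rightarrow> nat \<Rightarrow> (nat \<Rightarrow> nat \<Rightarrow> real) \<Rightarrow> bool" where
  "full_row_rank m n A \<longleftrightarrow>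
     (\<forall>y::nat \<Rightarrow> real. (\<forall>j<n. (\<Sum>i<m. y i * A i j) = 0) \<longrightarrow> (\<forall>i<m. y i = 0))"

definition kerA :: "nat \<Rightarrow> nat \<Rightarrow> (nat \<Rightarrow> nat \<Rightarrow> real) \<Rightarrow> (nat \<Rightarrow> real) set" where
  "kerA m n A = {x. rvec n x \<and> (\<forall>i<m. matvec n A x i = 0)}"

definition supp :: "nat \<Rightarrow> (nat \<Rightarrow> real) \<Rightarrow> nat set" where
  "supp n g = {j. j < n \<and> g j \<noteq> 0}"

definition elementary :: "nat \<Rightarrow> nat \<Rightarrow> (nat \<Rightarrow> nat \<Rightarrow> real) \<Rightarrow> (nat \<Rightarrow> real) \<Rightarrow> bool" where
  "elementary m n A g \<longleftrightarrow> g \<in> kerA m n A \<and> g \<noteq> (\<lambda>_. 0) \<and>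
     \<not> (\<exists>h \<in> kerA m n A. h \<noteq> (\<lambda>_. 0) \<and> supp n h \<subset> supp n g)"

definition kappa :: "nat \<Rightarrow> nat \<Rightarrow> (nat \<Rightarrow> nat \<Rightarrow> real) \<Rightarrow> real" where
  "kappa m n A = Sup {\<bar>g i\<bar> / \<bar>g j\<bar> | g i j.
      elementary m n A g \<and> i \<in> supp n g \<and> j \<in> supp n g}"

definition polyP :: "nat \<Rightarrow> nat \<Rightarrow> (nat \<Rightarrow> nat \<Rightarrow> real) \<Rightarrow> (nat \<Rightarrow> real) \<Rightarrow> (nat \<Rightarrow> real) set" where
  "polyP m n A b = {x. rvec n x \<and> (\<forall>i<m. matvec n A x i = b i) \<and> (\<forall>j<n. x j \<ge> 0)}"

definition vertex :: "(nat \<Rightarrow> real) set \<Rightarrow> (nat \<Rightarrow> real) \<Rightarrow> bool" where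
  "vertex P x \<longleftrightarrow> x \<in> P \<and>
     \<not> (\<exists>y\<in>P. \<exists>z\<in>P. \<exists>t::real. y \<noteq> z \<and> 0 < t \<and> t < 1 \<and> x = (\<lambda>j. t * y j + (1 - t) * z j))"

text \<open>A circuit walk: list [x1, ..., x(k+1)] in P, each step a maximal elementary step;
  its length is k = length xs - 1.\<close>
definition circuit_walk :: "nat \<Rightarrow> nat \<Rightarrow> (nat \<Rightarrow> nat \<Rightarrow> real) \<Rightarrow> (nat \<Rightarrow> real) set
    \<Rightarrow> (nat \<Rightarrow> real) list \<Rightarrow> bool" where
  "circuit_walk m n A P xs \<longleftrightarrow> xs \<noteq> [] \<and> set xs \<subseteq> P \<and>
     (\<forall>i. Suc i < length xs \<longrightarrow>
        (\<exists>g. elementary m n A g \<and> xs ! Suc i = (\<lambda>j. (xs ! i) j + g j) \<and>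
             (\<forall>\<epsilon>::real. \<epsilon> > 0 \<longrightarrow> (\<lambda>j. (xs ! i) j + (1 + \<epsilon>) * g j) \<notin> P)))"

end

theory Submission
  imports Defs
begin

text \<open>Let \<open>B\<close> be a basis containing the support of the target \<open>y\<close>, \<open>N\<close> its complement and \<open>D x\<close>
  the mass of \<open>x\<close> on \<open>N\<close>. A conformal circuit decomposition of \<open>y - x\<close> has at most
  \<open>p = min m (n - m)\<close> circuits. Augmenting maximally along the one with the largest mass on \<open>N\<close>
  shrinks \<open>D\<close> by the factor \<open>1 - 1/p\<close>, and \<open>\<bar>y i - x i\<bar> \<le> \<kappa> * D x\<close> throughout.
  Consider the set \<open>U\<close> of coordinates with \<open>x i > p * y i\<close> and the set \<open>V\<close> of coordinates in the
  support of \<open>y\<close> with \<open>y i \<le> \<kappa> * D x\<close>. Both only shrink along the walk and have at most \<open>m\<close>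
  elements at the start. The coordinate that blocks a step leaves \<open>U\<close> immediately or, since it
  then was comparable to \<open>D x\<close>, leaves \<open>V\<close> after \<open>O(p log(m + \<kappa>))\<close> further steps.\<close>

section \<open>Linear algebra of the kernel\<close>

text \<open>Gaussian elimination, one equation at a time: an equation with a nonzero coefficient at
  \<open>q\<close> determines the variable \<open>q\<close>, and substituting it leaves one equation
  and one variable fewer. The lemma bounds independent sets, extends them to bases and limits the
  number of circuits in a decomposition.\<close>

lemma homogeneous_system_nontrivial:
  fixes a :: "'i \<Rightarrow> 'j \<Rightarrow> real"
  assumes "finite I" "finite J" "card I < card J"
  shows "\<exists>c. (\<exists>j\<in>J. c j \<noteq> 0) \<and> (\<forall>i\<in>I. (\<Sum>j\<in>J. a i j * c j) = 0)"
  using assms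
proof (induction I arbitrary: J a rule: finite_induct)
  case empty
  then have "J \<noteq> {}" by auto
  then show ?case by (intro exI[of _ "\<lambda>_. 1"]) auto
next
  case (insert i I)
  show ?case
  proof (cases "\<forall>j\<in>J. a i j = 0")
    case True
    from insert.hyps insert.prems have "card I < card J" by simp
    from insert.IH[OF insert.prems(1) this, of a] obtain c where
      "\<exists>j\<in>J. c j \<noteq> 0" "\<forall>i\<in>I. (\<Sum>j\<in>J. a i j * c j) = 0" by blast
    with True show ?thesis by (intro exI[of _ c]) auto
  next
    case False
    then obtain q where q: "q \<in> J" "a i q \<noteq> 0" by blast
    define K where "K = J - {q}"
    have K: "finite K" "q \<notin> K" "J = insert q K" using q insert.prems by (auto simp: K_def)
    then have "card I < card K" using insert.hyps insert.prems by simp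
    from insert.IH[OF K(1) this, of "\<lambda>k j. a k j - a k q * a i j / a i q"] obtain c where
      c: "\<exists>j\<in>K. c j \<noteq> 0" "\<And>k. k \<in> I \<Longrightarrow> (\<Sum>j\<in>K. (a k j - a k q * a i j / a i q) * c j) = 0"
      by blast
    define s where "s = (\<Sum>j\<in>K. a i j * c j)"
    define d where "d = c(q := - s / a i q)"
    have split: "(\<Sum>j\<in>J. a k j * d j) = (\<Sum>j\<in>K. a k j * c j) - a k q * s / a i q" for k
    proof -
      have "(\<Sum>j\<in>K. a k j * d j) = (\<Sum>j\<in>K. a k j * c j)"
        by (intro sum.cong) (use K in \<open>auto simp: d_def\<close>)
      then show ?thesis using K by (simp add: d_def)
    qed
    have "(\<Sum>j\<in>J. a k j * d j) = 0" if "k \<in> I" for k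
    proof -
      have "(\<Sum>j\<in>K. (a k j - a k q * a i j / a i q) * c j)
          = (\<Sum>j\<in>K. a k j * c j) - a k q * s / a i q"
        by (simp add: s_def sum_subtractf sum_distrib_left sum_divide_distrib algebra_simps)
      then show ?thesis using c(2)[OF that] split by simp
    qed
    moreover have "(\<Sum>j\<in>J. a i j * d j) = 0" using q split[of i] by (simp add: s_def)
    moreover have "\<exists>j\<in>J. d j \<noteq> 0" using c(1) K by (auto simp: d_def)
    ultimately show ?thesis by (intro exI[of _ d]) auto
  qed
qed

lemma finite_ex_minimum:
  fixes f :: "'a \<Rightarrow> real"
  assumes "finite I" "I \<noteq> {}"
  shows "\<exists>i\<in>I. \<forall>j\<in>I. f i \<le> f j"
  using arg_min_if_finite(1)[OF assms, of f] arg_min_least[OF assms, of _ f] by blast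

lemma kerA_lincomb:
  assumes "z \<in> kerA m n A" "w \<in> kerA m n A"
  shows "(\<lambda>j. s * z j + t * w j) \<in> kerA m n A"
proof -
  have "(\<Sum>j<n. A i j * (s * z j + t * w j)) = s * (\<Sum>j<n. A i j * z j) + t * (\<Sum>j<n. A i j * w j)" for i
    by (simp add: sum_distrib_left sum.distrib algebra_simps)
  then show ?thesis using assms by (auto simp: kerA_def rvec_def matvec_def)
qed

lemma kerA_diff:
  assumes "z \<in> kerA m n A" "w \<in> kerA m n A"
  shows "(\<lambda>j. z j - t * w j) \<in> kerA m n A"
  using kerA_lincomb[OF assms, of 1 "- t"] by simp

lemma kerA_scale: "z \<in> kerA m n A \<Longrightarrow> (\<lambda>j. t * z j) \<in> kerA m n A"
  using kerA_lincomb[of z m n A z t 0] by simp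

lemma kerA_sum:
  assumes "\<And>l. l < k \<Longrightarrow> h l \<in> kerA m n A"
  shows "(\<lambda>j. \<Sum>l<(k::nat). c l * h l j) \<in> kerA m n A"
  using assms
proof (induction k)
  case 0
  then show ?case by (simp add: kerA_def rvec_def matvec_def)
next
  case (Suc k)
  then have "(\<lambda>j. \<Sum>l<k. c l * h l j) \<in> kerA m n A" "h k \<in> kerA m n A" by auto
  from kerA_lincomb[OF this, of 1 "c k"] show ?case by simp
qed

lemma kerA_nonzero_supp:
  assumes "z \<in> kerA m n A" "z \<noteq> (\<lambda>_. 0)"
  shows "supp n z \<noteq> {}"
proof -
  obtain i where "z i \<noteq> 0" using assms(2) by auto
  then have "i \<in> supp n z" using assms(1) by (auto simp: kerA_def rvec_def supp_def not_less[symmetric])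
  then show ?thesis by auto
qed

lemma finite_supp [simp]: "finite (supp n z)"
  by (simp add: supp_def)

lemma polyP_diff_kerA:
  assumes "x \<in> polyP m n A b" "y \<in> polyP m n A b"
  shows "(\<lambda>j. y j - x j) \<in> kerA m n A"
  using assms by (auto simp: polyP_def kerA_def rvec_def matvec_def right_diff_distrib sum_subtractf)

lemma polyP_add_kerA:
  assumes "x \<in> polyP m n A b" "z \<in> kerA m n A" "\<And>j. j < n \<Longrightarrow> 0 \<le> x j + t * z j"
  shows "(\<lambda>j. x j + t * z j) \<in> polyP m n A b"
proof -
  have "(\<Sum>j<n. A i j * (x j + t * z j)) = (\<Sum>j<n. A i j * x j) + t * (\<Sum>j<n. A i j * z j)" for i
    by (simp add: sum_distrib_left sum.distrib algebra_simps)
  then show ?thesis using assms by (auto simp: polyP_def kerA_def rvec_def matvec_def)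
qed

section \<open>Linearly independent sets of columns, vertices and bases\<close>

definition indep_cols :: "nat \<Rightarrow> nat \<Rightarrow> (nat \<Rightarrow> nat \<Rightarrow> real) \<Rightarrow> nat set \<Rightarrow> bool" where
  "indep_cols m n A I \<longleftrightarrow>
     I \<subseteq> {..<n} \<and> (\<forall>z\<in>kerA m n A. supp n z \<subseteq> I \<longrightarrow> z = (\<lambda>_. 0))"

lemma indep_cols_card_le:
  assumes "indep_cols m n A I"
  shows "card I \<le> m"
proof (rule ccontr)
  assume "\<not> card I \<le> m"
  moreover have I: "I \<subseteq> {..<n}" "finite I"
    using assms finite_subset by (auto simp: indep_cols_def)
  ultimately obtain c where
    c: "\<exists>j\<in>I. c j \<noteq> 0" "\<forall>i\<in>{..<m}. (\<Sum>j\<in>I. A i j * c j) = 0"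
    using homogeneous_system_nontrivial[of "{..<m}" I A] by auto
  define z where "z = (\<lambda>j. if j \<in> I then c j else 0)"
  have "(\<Sum>j<n. A i j * z j) = (\<Sum>j\<in>I. A i j * c j)" for i
    by (intro sum.mono_neutral_cong_right) (use I in \<open>auto simp: z_def\<close>)
  with c(2) I(1) have "z \<in> kerA m n A"
    by (auto simp: kerA_def rvec_def matvec_def z_def subset_iff)
  moreover have "supp n z \<subseteq> I" by (auto simp: supp_def z_def)
  ultimately have "z = (\<lambda>_. 0)" using assms by (auto simp: indep_cols_def)
  with c(1) show False by (metis z_def)
qed

text \<open>A nonzero kernel vector supported in \<open>supp n x\<close> could be added to and
  subtracted from \<open>x\<close> in a small multiple without leaving the polyhedron, which would
  make \<open>x\<close> a midpoint of two other points.\<close>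

lemma vertex_indep_supp:
  assumes "vertex (polyP m n A b) x"
  shows "indep_cols m n A (supp n x)"
proof -
  have xP: "x \<in> polyP m n A b" using assms by (simp add: vertex_def)
  have "z = (\<lambda>_. 0)" if z: "z \<in> kerA m n A" "supp n z \<subseteq> supp n x" for z
  proof (rule ccontr)
    assume nz: "z \<noteq> (\<lambda>_. 0)"
    \<comment> \<open>The minimal ratio gives the largest \<open>e\<close> for which both
      \<open>x + e * z\<close> and \<open>x - e * z\<close> stay nonnegative.\<close>
    obtain q where q: "q \<in> supp n z" "\<forall>j\<in>supp n z. x q / \<bar>z q\<bar> \<le> x j / \<bar>z j\<bar>"
      using finite_ex_minimum[of "supp n z" "\<lambda>j. x j / \<bar>z j\<bar>"] kerA_nonzero_supp[OF z(1) nz] by auto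
    define e where "e = x q / \<bar>z q\<bar>"
    have "x q > 0" "z q \<noteq> 0" using q z(2) xP by (force simp: supp_def polyP_def less_le)+
    then have e: "e > 0" by (simp add: e_def)
    have bound: "e * \<bar>z j\<bar> \<le> x j" if "j < n" for j
    proof (cases "z j = 0")
      case True
      then show ?thesis using xP that by (auto simp: polyP_def)
    next
      case False
      then have "e \<le> x j / \<bar>z j\<bar>" using q(2) that by (auto simp: e_def supp_def)
      then show ?thesis using False by (simp add: field_simps)
    qed
    have "(\<lambda>j. x j + s * z j) \<in> polyP m n A b" if "\<bar>s\<bar> = e" for s
    proof (rule polyP_add_kerA[OF xP z(1)])
      fix j assume "j < n"
      then have "\<bar>s * z j\<bar> \<le> x j" using bound that by (simp add: abs_mult)
      then show "0 \<le> x j + s * z j" by linarith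
    qed
    from this[of e] this[of "- e"]
    have "(\<lambda>j. x j + e * z j) \<in> polyP m n A b" "(\<lambda>j. x j + (- e) * z j) \<in> polyP m n A b"
      using e by simp_all
    moreover have "(\<lambda>j. x j + e * z j) \<noteq> (\<lambda>j. x j + (- e) * z j)"
      using e \<open>z q \<noteq> 0\<close> by (auto dest!: fun_cong[of _ _ q])
    moreover have "x = (\<lambda>j. (1/2) * (x j + e * z j) + (1 - 1/2) * (x j + (- e) * z j))"
      by (simp add: field_simps)
    moreover have "0 < (1/2::real)" "(1/2::real) < 1" by auto
    ultimately show False using assms unfolding vertex_def by blast
  qed
  then show ?thesis by (auto simp: indep_cols_def supp_def)
qed

text \<open>Take a maximal independent superset \<open>B\<close>. With fewer than \<open>m\<close>
  columns it would admit a nonzero \<open>u\<close> orthogonal to all of them. By maximality every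
  other column depends on \<open>B\<close>, so \<open>u\<close> would be orthogonal to every column,
  against full row rank.\<close>

lemma basis_extension:
  assumes "full_row_rank m n A" "indep_cols m n A I"
  obtains B where "indep_cols m n A B" "I \<subseteq> B" "card B = m"
proof -
  define F where "F = {B. indep_cols m n A B \<and> I \<subseteq> B}"
  have "finite F" unfolding F_def
    by (rule finite_subset[of _ "Pow {..<n}"]) (auto simp: indep_cols_def)
  moreover have "I \<in> F" using assms(2) by (simp add: F_def)
  ultimately obtain B where "B \<in> F" and max: "\<And>C. C \<in> F \<Longrightarrow> B \<subseteq> C \<Longrightarrow> B = C"
    using finite_has_maximal[of F] by blast
  then have ind: "indep_cols m n A B" "I \<subseteq> B" by (auto simp: F_def)
  then have fin: "finite B" using finite_subset by (auto simp: indep_cols_def)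
  have "\<not> card B < m"
  proof
    assume "card B < m"
    then obtain u where u: "\<exists>i<m. u i \<noteq> 0" "\<forall>j\<in>B. (\<Sum>i<m. A i j * u i) = 0"
      using homogeneous_system_nontrivial[of B "{..<m}" "\<lambda>j i. A i j"] fin by auto
    have "(\<Sum>i<m. u i * A i j) = 0" if j: "j < n" for j
    proof (cases "j \<in> B")
      case True
      then show ?thesis using u by (simp add: mult.commute)
    next
      case False
      then have "\<not> indep_cols m n A (insert j B)"
        using max[of "insert j B"] ind(2) by (auto simp: F_def)
      then obtain z where z: "z \<in> kerA m n A" "supp n z \<subseteq> insert j B" "z \<noteq> (\<lambda>_. 0)"
        using j ind by (auto simp: indep_cols_def)
      have "z j \<noteq> 0"
      proof
        assume "z j = 0"
        then have "supp n z \<subseteq> B" using z(2) by (auto simp: supp_def)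
        then show False using ind z by (auto simp: indep_cols_def)
      qed
      \<comment> \<open>The bilinear expression in \<open>u\<close>, \<open>A\<close> and
        \<open>z\<close> is summed in both orders: it vanishes because \<open>z\<close> is in the
        kernel, and columnwise only the term of the new column \<open>j\<close> survives.\<close>
      have "0 = (\<Sum>i<m. u i * (\<Sum>k<n. A i k * z k))"
        using z(1) by (simp add: kerA_def matvec_def)
      also have "\<dots> = (\<Sum>i<m. \<Sum>k<n. z k * (u i * A i k))"
        by (simp add: sum_distrib_left algebra_simps)
      also have "\<dots> = (\<Sum>k<n. z k * (\<Sum>i<m. u i * A i k))"
        by (subst sum.swap) (simp add: sum_distrib_left)
      also have "\<dots> = (\<Sum>k\<in>{j}. z k * (\<Sum>i<m. u i * A i k))"
      proof (intro sum.mono_neutral_right ballI)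
        fix k assume k: "k \<in> {..<n} - {j}"
        show "z k * (\<Sum>i<m. u i * A i k) = 0"
        proof (cases "k \<in> B")
          case True
          then show ?thesis using u by (simp add: mult.commute)
        next
          case False
          then show ?thesis using z(2) k by (auto simp: supp_def)
        qed
      qed (use j in auto)
      finally show ?thesis using \<open>z j \<noteq> 0\<close> by simp
    qed
    then show False using u(1) assms(1) by (auto simp: full_row_rank_def)
  qed
  with indep_cols_card_le[OF ind(1)] have "card B = m" by simp
  with ind show ?thesis using that by blast
qed

section \<open>Conformal circuit decompositions\<close>

lemma elementary_scale:
  assumes "elementary m n A g" "t \<noteq> 0"
  shows "elementary m n A (\<lambda>j. t * g j)"
proof -
  have "supp n (\<lambda>j. t * g j) = supp n g" using assms(2) by (auto simp: supp_def)
  then show ?thesis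
    using assms kerA_scale[of g m n A t] by (auto simp: elementary_def fun_eq_iff)
qed

text \<open>Where \<open>z\<close> is zero both implications apply, so \<open>h\<close> vanishes
  there too; the support of \<open>h\<close> is thus contained in that of \<open>z\<close>.\<close>

definition same_signs :: "(nat \<Rightarrow> real) \<Rightarrow> (nat \<Rightarrow> real) \<Rightarrow> bool" where
  "same_signs h z \<longleftrightarrow> (\<forall>i. (0 \<le> z i \<longrightarrow> 0 \<le> h i) \<and> (z i \<le> 0 \<longrightarrow> h i \<le> 0))"

text \<open>Stronger than \<open>same_signs\<close>: the entries are also bounded by those of
  \<open>z\<close>, as holds for the summands of a decomposition without cancellation.\<close>

definition conformal :: "(nat \<Rightarrow> real) \<Rightarrow> (nat \<Rightarrow> real) \<Rightarrow> bool" where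
  "conformal h z \<longleftrightarrow> (\<forall>i. (0 \<le> h i \<and> h i \<le> z i) \<or> (z i \<le> h i \<and> h i \<le> 0))"

text \<open>Induction on the support. If \<open>z\<close> is not elementary, a multiple of a kernel
  vector \<open>g\<close> of smaller support is subtracted until a first coordinate becomes zero.
  The rest \<open>w\<close> keeps the signs of \<open>z\<close>, and it is nonzero because
  \<open>g\<close> vanishes somewhere on the support of \<open>z\<close>.\<close>

lemma elementary_same_signs_exists:
  assumes "z \<in> kerA m n A" "z \<noteq> (\<lambda>_. 0)"
  shows "\<exists>h. elementary m n A h \<and> same_signs h z"
  using assms
proof (induction "card (supp n z)" arbitrary: z rule: less_induct)
  case less
  show ?case
  proof (cases "elementary m n A z")
    case True
    then show ?thesis by (intro exI[of _ z]) (simp add: same_signs_def)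
  next
    case False
    then obtain g0 where g0: "g0 \<in> kerA m n A" "g0 \<noteq> (\<lambda>_. 0)" "supp n g0 \<subset> supp n z"
      using less.prems by (auto simp: elementary_def)
    obtain i1 where i1: "i1 \<in> supp n g0" using kerA_nonzero_supp[OF g0(1,2)] by auto
    \<comment> \<open>The sign is chosen so that \<open>g\<close> agrees with \<open>z\<close> at
      \<open>i1\<close>, which gives the ratio test below at least one candidate.\<close>
    define g where "g = (\<lambda>j. sgn (g0 i1 * z i1) * g0 j)"
    have "g0 i1 * z i1 \<noteq> 0" using i1 g0(3) by (auto simp: supp_def)
    then have sg: "sgn (g0 i1 * z i1) \<noteq> 0" and g1: "g i1 * z i1 > 0"
      by (auto simp: g_def sgn_mult sgn_if mult_less_0_iff zero_less_mult_iff not_less le_less)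
    have g: "g \<in> kerA m n A" "supp n g \<subset> supp n z"
      using kerA_scale[OF g0(1)] sg g0(3) by (auto simp: g_def supp_def)
    let ?I = "{i. i < n \<and> g i * z i > 0}"
    have "i1 \<in> ?I" using g1 i1 by (auto simp: supp_def)
    \<comment> \<open>Coordinates where the signs disagree only move away from zero, so the smallest
      ratio over the agreeing ones is the first zero that is met.\<close>
    then obtain q where q: "q \<in> ?I" "\<forall>j\<in>?I. z q / g q \<le> z j / g j"
      using finite_ex_minimum[of ?I "\<lambda>j. z j / g j"] by auto
    define s where "s = z q / g q"
    have s: "s > 0" using q(1) by (auto simp: s_def zero_less_divide_iff zero_less_mult_iff)
    define w where "w = (\<lambda>j. z j - s * g j)"
    have w: "w \<in> kerA m n A" unfolding w_def by (rule kerA_diff) (use less.prems g in auto)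
    have gz: "g j = 0" if "z j = 0 \<or> j \<ge> n" for j
      using that g by (auto simp: supp_def kerA_def rvec_def not_le[symmetric])
    have ss: "same_signs w z" unfolding same_signs_def
    proof (intro allI)
      fix i
      have "s \<le> z i / g i" if "g i * z i > 0"
      proof -
        have "i < n" using gz[of i] that by (cases "i < n") auto
        then show ?thesis using q(2) that by (auto simp: s_def)
      qed
      then have b: "s * g i \<le> z i" if "g i > 0" "z i > 0" using that by (simp add: pos_le_divide_eq)
      have c: "s * g i \<ge> z i" if "g i < 0" "z i < 0"
        using that \<open>g i * z i > 0 \<Longrightarrow> s \<le> z i / g i\<close> by (simp add: mult_neg_neg neg_le_divide_eq)
      have "s * g i \<le> 0" if "g i \<le> 0" using that s by (simp add: mult_le_0_iff)
      moreover have "0 \<le> s * g i" if "g i \<ge> 0" using that s by simp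
      ultimately show "(0 \<le> z i \<longrightarrow> 0 \<le> w i) \<and> (z i \<le> 0 \<longrightarrow> w i \<le> 0)"
        using b c gz[of i] unfolding w_def by (smt (verit))
    qed
    have "supp n w \<subseteq> supp n z" using gz by (auto simp: supp_def w_def)
    moreover have "w q = 0" "q \<in> supp n z" using q(1) by (auto simp: w_def s_def supp_def)
    ultimately have "supp n w \<subset> supp n z" by (auto simp: supp_def)
    then have "card (supp n w) < card (supp n z)" by (simp add: psubset_card_mono)
    moreover have "w \<noteq> (\<lambda>_. 0)"
    proof -
      obtain r where "r \<in> supp n z" "r \<notin> supp n g" using g(2) by auto
      then have "w r \<noteq> 0" by (auto simp: w_def supp_def)
      then show ?thesis by auto
    qed
    ultimately obtain h where "elementary m n A h" "same_signs h w" using less.hyps w by blast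
    then show ?thesis using ss by (intro exI[of _ h]) (auto simp: same_signs_def)
  qed
qed

text \<open>A circuit with the signs of \<open>z\<close> is scaled up until it meets
  \<open>z\<close> at some coordinate \<open>q\<close>. Subtracting it then removes \<open>q\<close>
  from the support.\<close>

lemma elementary_conformal_exists:
  assumes "z \<in> kerA m n A" "z \<noteq> (\<lambda>_. 0)"
  obtains h q where "elementary m n A h" "conformal h z" "q < n" "h q = z q" "z q \<noteq> 0"
proof -
  obtain g where g: "elementary m n A g" "same_signs g z"
    using elementary_same_signs_exists[OF assms] by blast
  have gk: "g \<in> kerA m n A" "g \<noteq> (\<lambda>_. 0)" using g by (auto simp: elementary_def)
  obtain q where q: "q \<in> supp n g" "\<forall>j\<in>supp n g. z q / g q \<le> z j / g j"
    using finite_ex_minimum[of "supp n g" "\<lambda>j. z j / g j"] kerA_nonzero_supp[OF gk] by auto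
  define s where "s = z q / g q"
  have pos: "(0 < g i \<and> 0 < z i) \<or> (g i < 0 \<and> z i < 0)" if "g i \<noteq> 0" for i
    using g(2) that unfolding same_signs_def by (smt (verit))
  have s: "s > 0" using pos[of q] q(1) by (auto simp: s_def supp_def zero_less_divide_iff)
  have "conformal (\<lambda>j. s * g j) z" unfolding conformal_def
  proof
    fix i
    show "(0 \<le> s * g i \<and> s * g i \<le> z i) \<or> (z i \<le> s * g i \<and> s * g i \<le> 0)"
    proof (cases "g i = 0")
      case True
      then show ?thesis by auto
    next
      case False
      then have "i < n" using gk by (auto simp: kerA_def rvec_def not_le[symmetric])
      then have "s \<le> z i / g i" using q(2) False by (auto simp: s_def supp_def)
      then show ?thesis using pos[OF False] s
        by (auto simp: pos_le_divide_eq neg_le_divide_eq mult_le_0_iff)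
    qed
  qed
  moreover have "elementary m n A (\<lambda>j. s * g j)" using elementary_scale g s by simp
  moreover have "q < n" "s * g q = z q" "z q \<noteq> 0"
    using q(1) pos[of q] by (auto simp: supp_def s_def)
  ultimately show ?thesis using that by blast
qed

text \<open>Circuits are peeled off one by one, each removing a coordinate from the support. The
  last clause, linear independence of the circuits, later bounds their number by a number of
  coordinates of \<open>N\<close>.\<close>

lemma conformal_decomposition:
  assumes "z \<in> kerA m n A"
  shows "\<exists>(k::nat) h. (\<forall>l<k. elementary m n A (h l) \<and> conformal (h l) z) \<and>
    (\<forall>i. z i = (\<Sum>l<k. h l i)) \<and>
    (\<forall>c. (\<forall>i. (\<Sum>l<k. c l * h l i) = 0) \<longrightarrow> (\<forall>l<k. c l = 0))"
  using assms
proof (induction "card (supp n z)" arbitrary: z rule: less_induct)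
  case less
  show ?case
  proof (cases "z = (\<lambda>_. 0)")
    case True
    then show ?thesis by (intro exI[of _ 0]) auto
  next
    case False
    obtain g q where g: "elementary m n A g" "conformal g z" "q < n" "g q = z q" "z q \<noteq> 0"
      using elementary_conformal_exists[OF less.prems False] .
    define w where "w = (\<lambda>j. z j - g j)"
    have w: "w \<in> kerA m n A"
      using kerA_diff[OF less.prems, of g 1] g by (simp add: w_def elementary_def)
    have "supp n w \<subseteq> supp n z"
    proof
      fix i assume "i \<in> supp n w"
      then show "i \<in> supp n z"
        using g(2) unfolding conformal_def supp_def w_def mem_Collect_eq by (smt (verit))
    qed
    moreover have "q \<in> supp n z" "q \<notin> supp n w" using g by (auto simp: supp_def w_def)
    ultimately have "supp n w \<subset> supp n z" by auto
    then have "card (supp n w) < card (supp n z)" by (simp add: psubset_card_mono)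
    from less.hyps[OF this w] obtain k h where
      h: "\<And>l. l < k \<Longrightarrow> elementary m n A (h l)" "\<And>l. l < k \<Longrightarrow> conformal (h l) w"
      "\<And>i. w i = (\<Sum>l<(k::nat). h l i)"
      "\<And>c. (\<forall>i. (\<Sum>l<k. c l * h l i) = 0) \<Longrightarrow> (\<forall>l<k. c l = 0)" by blast
    define h' where "h' = h(k := g)"
    have conf: "conformal (h l) z" if "l < k" for l
      unfolding conformal_def
    proof
      fix i
      show "(0 \<le> h l i \<and> h l i \<le> z i) \<or> (z i \<le> h l i \<and> h l i \<le> 0)"
        using h(2)[OF that] g(2) unfolding conformal_def w_def by (smt (verit))
    qed
    have sum': "(\<Sum>l<Suc k. c l * h' l i) = (\<Sum>l<k. c l * h l i) + c k * g i" for c i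
      by (simp add: h'_def)
    show ?thesis
    proof (intro exI[of _ "Suc k"] exI[of _ h'] conjI allI impI)
      fix l assume "l < Suc k"
      then show "elementary m n A (h' l)" "conformal (h' l) z"
        using g h(1) conf by (auto simp: h'_def)
    next
      fix i
      show "z i = (\<Sum>l<Suc k. h' l i)" using h(3)[of i] sum'[of "\<lambda>_. 1" i] by (simp add: w_def)
    next
      fix c l assume c: "\<forall>i. (\<Sum>l<Suc k. c l * h' l i) = 0" and l: "l < Suc k"
      \<comment> \<open>The system is triangular: the coordinate \<open>q\<close> is zero in the
        remainder \<open>w\<close>, hence in all circuits conformal to it, so \<open>q\<close>
        isolates the coefficient of \<open>g\<close>.\<close>
      have "h l q = 0" if "l < k" for l
        using h(2)[OF that] g(4) by (auto simp: conformal_def w_def dest: spec[of _ q])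
      moreover have split: "(\<Sum>l<k. c l * h l i) + c k * g i = 0" for i
        using c[rule_format, of i] unfolding sum' .
      ultimately have "c k * g q = 0" using split[of q] by simp
      then have "c k = 0" using g by simp
      moreover from this have "\<forall>l<k. c l = 0" using split by (intro h(4)) simp
      ultimately show "c l = 0" using l by (auto simp: less_Suc_eq)
    qed
  qed
qed

lemma conformal_sum_abs:
  assumes "\<And>l. l < k \<Longrightarrow> conformal (h l) z" "z i = (\<Sum>l<(k::nat). h l i)"
  shows "(\<Sum>l<k. \<bar>h l i\<bar>) = \<bar>z i\<bar>"
proof (cases "z i \<ge> 0")
  case True
  then have "h l i \<ge> 0" if "l < k" for l
    using assms(1)[OF that] unfolding conformal_def by (smt (verit))
  then have "(\<Sum>l<k. \<bar>h l i\<bar>) = (\<Sum>l<k. h l i)" by (intro sum.cong) auto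
  then show ?thesis using True assms by simp
next
  case False
  then have "h l i \<le> 0" if "l < k" for l
    using assms(1)[OF that] unfolding conformal_def by (smt (verit))
  then have "(\<Sum>l<k. \<bar>h l i\<bar>) = (\<Sum>l<k. - h l i)" by (intro sum.cong) auto
  then show ?thesis using False assms by (simp add: sum_negf)
qed

section \<open>The circuit imbalance measure\<close>

text \<open>The combination that cancels coordinate \<open>j\<close> has strictly smaller support,
  so minimality forces it to be zero.\<close>

lemma elementary_same_supp:
  assumes "elementary m n A g" "elementary m n A h" "supp n g = supp n h" "j \<in> supp n g"
  shows "h i = (h j / g j) * g i"
proof -
  define w where "w = (\<lambda>i. h i - (h j / g j) * g i)"
  have "w \<in> kerA m n A"
    unfolding w_def by (rule kerA_diff) (use assms in \<open>auto simp: elementary_def\<close>)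
  moreover have "supp n w \<subset> supp n h"
  proof -
    have "supp n w \<subseteq> supp n g \<union> supp n h" by (auto simp: supp_def w_def)
    moreover have "j \<notin> supp n w" using assms(4) by (auto simp: w_def supp_def)
    ultimately show ?thesis using assms(3,4) by blast
  qed
  ultimately have "w = (\<lambda>_. 0)" using assms(2) by (auto simp: elementary_def)
  from fun_cong[OF this, of i] show ?thesis by (simp add: w_def)
qed

text \<open>The supremum defining \<open>kappa\<close> is an upper bound because it ranges over a
  finite set: circuits with equal support are proportional, so a ratio depends only on the support
  and the pair of indices.\<close>

lemma elementary_ratio_le_kappa:
  assumes "elementary m n A g" "i \<in> supp n g" "j \<in> supp n g"
  shows "\<bar>g i\<bar> / \<bar>g j\<bar> \<le> kappa m n A"
proof -
  let ?R = "{\<bar>g i\<bar> / \<bar>g j\<bar> | g i j. elementary m n A g \<and> i \<in> supp n g \<and> j \<in> supp n g}"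
  define rep where "rep S = (SOME g. elementary m n A g \<and> supp n g = S)" for S
  have "?R \<subseteq> (\<lambda>(S, i, j). \<bar>rep S i\<bar> / \<bar>rep S j\<bar>) ` (Pow {..<n} \<times> {..<n} \<times> {..<n})"
  proof clarify
    fix g i j assume g: "elementary m n A g" "i \<in> supp n g" "j \<in> supp n g"
    define r where "r = rep (supp n g)"
    have r: "elementary m n A r \<and> supp n r = supp n g"
      unfolding r_def rep_def by (rule someI[of _ g]) (use g in simp)
    have e: "r i = (r j / g j) * g i" using elementary_same_supp[of m n A g r j i] g r by simp
    have "g j \<noteq> 0" "r j \<noteq> 0" using g(3) r by (auto simp: supp_def)
    then have "\<bar>g i\<bar> / \<bar>g j\<bar> = \<bar>r i\<bar> / \<bar>r j\<bar>"
      unfolding e by (simp add: abs_mult)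
    moreover have "(supp n g, i, j) \<in> Pow {..<n} \<times> {..<n} \<times> {..<n}" using g by (auto simp: supp_def)
    ultimately show "\<bar>g i\<bar> / \<bar>g j\<bar> \<in> (\<lambda>(S, i, j). \<bar>rep S i\<bar> / \<bar>rep S j\<bar>) ` (Pow {..<n} \<times> {..<n} \<times> {..<n})"
      unfolding r_def by (intro image_eqI[of _ _ "(supp n g, i, j)"]) auto
  qed
  then have "finite ?R" by (rule finite_subset) auto
  then have "bdd_above ?R" by (rule bdd_above_finite)
  then show ?thesis unfolding kappa_def by (rule cSup_upper[rotated]) (use assms in blast)
qed

text \<open>The ratio of an entry to itself is 1. Some circuit has to exist, since otherwise
  \<open>kappa\<close> is the supremum of the empty set.\<close>

lemma one_le_kappa:
  assumes "elementary m n A g"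
  shows "1 \<le> kappa m n A"
proof -
  obtain i where i: "i \<in> supp n g"
    using kerA_nonzero_supp[of g m n A] assms by (auto simp: elementary_def)
  then show ?thesis using elementary_ratio_le_kappa[OF assms i i] by (simp add: supp_def)
qed

lemma elementary_abs_le:
  assumes "elementary m n A g" "j \<in> supp n g"
  shows "\<bar>g i\<bar> \<le> kappa m n A * \<bar>g j\<bar>"
proof (cases "i \<in> supp n g")
  case True
  then show ?thesis
    using elementary_ratio_le_kappa[OF assms(1) True assms(2)] assms(2)
    by (simp add: supp_def divide_le_eq)
next
  case False
  then have "g i = 0" using assms(1) by (auto simp: supp_def elementary_def kerA_def rvec_def not_less)
  then show ?thesis using one_le_kappa[OF assms(1)] by simp
qed

section \<open>Augmentation step towards a basic solution\<close>

locale basic_target =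
  fixes m n :: nat and A :: "nat \<Rightarrow> nat \<Rightarrow> real" and b :: "nat \<Rightarrow> real"
    and y :: "nat \<Rightarrow> real" and B :: "nat set"
  assumes target: "y \<in> polyP m n A b"
    and basis: "indep_cols m n A B" "card B = m" "supp n y \<subseteq> B"
begin

abbreviation "P \<equiv> polyP m n A b"
abbreviation "\<kappa> \<equiv> kappa m n A"

definition N :: "nat set" where "N = {..<n} - B"

text \<open>Since \<open>y\<close> vanishes on \<open>N\<close>, for \<open>x\<close> in
  \<open>P\<close> this is the l1 distance from \<open>x\<close> to \<open>y\<close> measured on
  \<open>N\<close>; it serves as the progress measure of the walk.\<close>

definition D :: "(nat \<Rightarrow> real) \<Rightarrow> real" where "D x = (\<Sum>j\<in>N. x j)"

lemma finite_N [simp]: "finite N" by (simp add: N_def)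

lemma target_N: "j \<in> N \<Longrightarrow> y j = 0"
  using basis by (auto simp: N_def supp_def)

lemma P_nonneg: "x \<in> P \<Longrightarrow> 0 \<le> x j"
  by (cases "j < n") (auto simp: polyP_def rvec_def)

lemma D_nonneg: "x \<in> P \<Longrightarrow> 0 \<le> D x"
  unfolding D_def by (intro sum_nonneg P_nonneg)

lemma kerA_zero_on_N:
  assumes "z \<in> kerA m n A" "\<And>j. j \<in> N \<Longrightarrow> z j = 0"
  shows "z = (\<lambda>_. 0)"
proof -
  have "supp n z \<subseteq> B" using assms(2) by (auto simp: supp_def N_def)
  then show ?thesis using basis(1) assms(1) by (auto simp: indep_cols_def)
qed

text \<open>Every circuit of a conformal decomposition has a nonzero entry on \<open>N\<close>,
  because the columns in \<open>B\<close> are independent. Its other entries are at most \<kappa>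
  times that one, and the bounds add up without cancellation.\<close>

lemma kerA_abs_le:
  assumes "z \<in> kerA m n A"
  shows "\<bar>z i\<bar> \<le> \<kappa> * (\<Sum>j\<in>N. \<bar>z j\<bar>)"
proof -
  obtain k h where h: "\<And>l. l < k \<Longrightarrow> elementary m n A (h l)" "\<And>l. l < k \<Longrightarrow> conformal (h l) z"
    "\<And>i. z i = (\<Sum>l<(k::nat). h l i)"
    using conformal_decomposition[OF assms] by blast
  have *: "\<bar>h l i\<bar> \<le> \<kappa> * (\<Sum>j\<in>N. \<bar>h l j\<bar>)" if l: "l < k" for l
  proof -
    have e: "elementary m n A (h l)" using h(1) l .
    obtain q where q: "q \<in> N" "h l q \<noteq> 0"
      using kerA_zero_on_N[of "h l"] e by (auto simp: elementary_def)
    then have "q \<in> supp n (h l)" by (auto simp: supp_def N_def)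
    then have "\<bar>h l i\<bar> \<le> \<kappa> * \<bar>h l q\<bar>" by (rule elementary_abs_le[OF e])
    also have "\<dots> \<le> \<kappa> * (\<Sum>j\<in>N. \<bar>h l j\<bar>)"
      using one_le_kappa[OF e] q by (intro mult_left_mono member_le_sum) auto
    finally show ?thesis .
  qed
  have "\<bar>z i\<bar> = (\<Sum>l<k. \<bar>h l i\<bar>)" using conformal_sum_abs[of k h z i] h by simp
  also have "\<dots> \<le> (\<Sum>l<k. \<kappa> * (\<Sum>j\<in>N. \<bar>h l j\<bar>))" by (intro sum_mono *) auto
  also have "\<dots> = \<kappa> * (\<Sum>j\<in>N. \<Sum>l<k. \<bar>h l j\<bar>)"
    by (subst sum.swap) (simp add: sum_distrib_left)
  also have "\<dots> = \<kappa> * (\<Sum>j\<in>N. \<bar>z j\<bar>)" using conformal_sum_abs[of k h z] h by simp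
  finally show ?thesis .
qed

lemma dist_target_le:
  assumes "x \<in> P"
  shows "\<bar>y i - x i\<bar> \<le> \<kappa> * D x"
proof -
  have "(\<Sum>j\<in>N. \<bar>y j - x j\<bar>) = D x"
    unfolding D_def by (intro sum.cong) (use target_N P_nonneg[OF assms] in auto)
  then show ?thesis using kerA_abs_le[OF polyP_diff_kerA[OF assms target], of i] by simp
qed

lemma D_zero_imp_target:
  assumes "x \<in> P" "\<And>j. j \<in> N \<Longrightarrow> x j = 0"
  shows "x = y"
proof -
  have "(\<lambda>j. y j - x j) = (\<lambda>_. 0)"
    by (rule kerA_zero_on_N[OF polyP_diff_kerA[OF assms(1) target]]) (use assms target_N in auto)
  then show ?thesis by (auto simp: fun_eq_iff)
qed

lemma D_pos:
  assumes "x \<in> P" "x \<noteq> y"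
  shows "D x > 0"
proof -
  have "D x \<noteq> 0"
  proof
    assume "D x = 0"
    then have "\<forall>j\<in>N. x j = 0"
      unfolding D_def using P_nonneg[OF assms(1)] by (subst (asm) sum_nonneg_eq_0_iff) auto
    then show False using D_zero_imp_target assms by blast
  qed
  then show ?thesis using D_nonneg[OF assms(1)] by simp
qed

text \<open>Properties of the maximal augmentation along the circuit of a conformal decomposition of
  \<open>y - x\<close> that carries the largest mass on \<open>N\<close>; there are at most \<open>p\<close> such circuits. The last
  clause concerns a coordinate \<open>i\<close> that blocks the step.\<close>
definition good_step :: "nat \<Rightarrow> (nat \<Rightarrow> real) \<Rightarrow> (nat \<Rightarrow> real) \<Rightarrow> bool" where
  "good_step p x x' \<longleftrightarrow> x' \<in> P \<and>
     (\<exists>g. elementary m n A g \<and> x' = (\<lambda>j. x j + g j) \<and>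
        (\<forall>\<epsilon>::real. \<epsilon> > 0 \<longrightarrow> (\<lambda>j. x j + (1 + \<epsilon>) * g j) \<notin> P)) \<and>
     D x' \<le> (1 - 1 / real p) * D x \<and>
     (\<forall>i. (x i \<le> x' i \<and> x' i \<le> x i + real p * (y i - x i)) \<or>
          (x' i \<le> x i \<and> x i + real p * (y i - x i) \<le> x' i)) \<and>
     (\<exists>i<n. y i < x i \<and> x' i = 0 \<and> D x \<le> \<kappa> * (real p)\<^sup>2 * x i)"

text \<open>A combination of the circuits that vanishes on the nonzero coordinates of
  \<open>x\<close> in \<open>N\<close> vanishes on all of \<open>N\<close>, hence entirely. By
  linear independence there are at most \<open>p\<close> circuits, and the heaviest carries at least
  the average mass.\<close>

lemma conformal_circuit_with_large_mass:
  assumes x: "x \<in> P" "x \<noteq> y" and p: "card {j \<in> N. x j \<noteq> 0} \<le> p"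
  obtains g where "elementary m n A g" "conformal g (\<lambda>j. y j - x j)"
    "D x \<le> real p * (\<Sum>j\<in>N. \<bar>g j\<bar>)"
proof -
  define z where "z = (\<lambda>j. y j - x j)"
  let ?I = "{j \<in> N. x j \<noteq> 0}"
  have z: "z \<in> kerA m n A" unfolding z_def by (rule polyP_diff_kerA[OF x(1) target])
  obtain k h where h: "\<And>l. l < k \<Longrightarrow> elementary m n A (h l)" "\<And>l. l < k \<Longrightarrow> conformal (h l) z"
    "\<And>i. z i = (\<Sum>l<(k::nat). h l i)"
    "\<And>c. (\<forall>i. (\<Sum>l<k. c l * h l i) = 0) \<Longrightarrow> (\<forall>l<k. c l = 0)"
    using conformal_decomposition[OF z] by blast
  have "k \<le> card ?I"
  proof (rule ccontr)
    assume "\<not> k \<le> card ?I"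
    then obtain c where c: "\<exists>l<k. c l \<noteq> 0" "\<forall>j\<in>?I. (\<Sum>l<k. h l j * c l) = 0"
      using homogeneous_system_nontrivial[of ?I "{..<k}" "\<lambda>j l. h l j"] by auto
    have "(\<lambda>j. \<Sum>l<k. c l * h l j) = (\<lambda>_. 0)"
    proof (rule kerA_zero_on_N)
      show "(\<lambda>j. \<Sum>l<k. c l * h l j) \<in> kerA m n A"
        by (rule kerA_sum) (use h(1) in \<open>auto simp: elementary_def\<close>)
      fix j assume j: "j \<in> N"
      show "(\<Sum>l<k. c l * h l j) = 0"
      proof (cases "x j = 0")
        case True
        \<comment> \<open>On \<open>N\<close> the target is zero, so where \<open>x\<close> is zero
          too, no conformal circuit has a nonzero entry.\<close>
        then have "z j = 0" using target_N[OF j] by (simp add: z_def)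
        then have "h l j = 0" if "l < k" for l
          using h(2)[OF that] by (auto simp: conformal_def dest: spec[of _ j])
        then show ?thesis by simp
      next
        case False
        then show ?thesis using c(2) j by (simp add: mult.commute)
      qed
    qed
    then have "\<forall>l<k. c l = 0" by (intro h(4)) (auto simp: fun_eq_iff)
    with c(1) show False by auto
  qed
  with p have kp: "k \<le> p" by simp
  have "k \<noteq> 0"
  proof
    assume "k = 0"
    then have "z = (\<lambda>_. 0)" using h(3) by auto
    then show False using x(2) by (auto simp: z_def fun_eq_iff)
  qed
  define W where "W l = (\<Sum>j\<in>N. \<bar>h l j\<bar>)" for l
  obtain q where q: "q < k" "\<forall>l<k. W l \<le> W q"
    using finite_ex_minimum[of "{..<k}" "\<lambda>l. - W l"] \<open>k \<noteq> 0\<close> by auto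
  have "D x = (\<Sum>j\<in>N. \<bar>z j\<bar>)"
    unfolding D_def z_def by (intro sum.cong) (use target_N P_nonneg[OF x(1)] in auto)
  also have "\<dots> = (\<Sum>j\<in>N. \<Sum>l<k. \<bar>h l j\<bar>)" using conformal_sum_abs[of k h z] h by simp
  also have "\<dots> = (\<Sum>l<k. W l)" unfolding W_def by (rule sum.swap)
  also have "\<dots> \<le> (\<Sum>l<k. W q)" by (intro sum_mono) (use q in auto)
  also have "\<dots> = real k * W q" by simp
  also have "\<dots> \<le> real p * W q"
    using kp by (intro mult_right_mono) (auto simp: W_def sum_nonneg)
  finally show ?thesis using that[of "h q"] h(1,2)[OF q(1)] by (simp add: W_def z_def)
qed

text \<open>Everything follows from \<open>1 \<le> a \<le> p\<close> for the maximal step length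
  \<open>a\<close>. The lower bound makes \<open>D\<close> lose at least the mass \<open>W\<close>
  of the circuit; the upper bound limits how far a coordinate can overshoot
  \<open>y\<close>.\<close>

lemma good_step_exists:
  assumes x: "x \<in> P" "x \<noteq> y" and p: "card {j \<in> N. x j \<noteq> 0} \<le> p"
  shows "\<exists>x'. good_step p x x'"
proof -
  obtain g where g: "elementary m n A g" "conformal g (\<lambda>j. y j - x j)"
    and mass: "D x \<le> real p * (\<Sum>j\<in>N. \<bar>g j\<bar>)"
    using conformal_circuit_with_large_mass[OF assms] .
  define W where "W = (\<Sum>j\<in>N. \<bar>g j\<bar>)"
  have gk: "g \<in> kerA m n A" using g by (simp add: elementary_def)
  have Dx: "D x > 0" using D_pos x by simp
  have W: "W > 0" "p > 0" "D x \<le> real p * W"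
  proof -
    show "D x \<le> real p * W" using mass by (simp add: W_def)
    then have "real p * W > 0" using Dx by simp
    moreover have "W \<ge> 0" by (simp add: W_def sum_nonneg)
    ultimately show "W > 0" "p > 0" by (auto simp: zero_less_mult_iff)
  qed
  have conf: "(0 \<le> g i \<and> g i \<le> y i - x i) \<or> (y i - x i \<le> g i \<and> g i \<le> 0)" for i
    using g(2) by (auto simp: conformal_def)
  have gN: "g j \<le> 0" if "j \<in> N" for j
    using conf[of j] target_N[OF that] P_nonneg[OF x(1), of j] by auto
  \<comment> \<open>Only decreasing coordinates can block. One exists because \<open>g\<close> has
    positive mass on \<open>N\<close>, where it is nonpositive.\<close>
  let ?I = "{i. i < n \<and> g i < 0}"
  have "?I \<noteq> {}"
  proof -
    have "\<exists>j\<in>N. g j \<noteq> 0" using W(1) unfolding W_def by (metis abs_zero less_irrefl sum.neutral)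
    then obtain j where "j \<in> N" "g j \<noteq> 0" by auto
    then have "j \<in> ?I" using gN[of j] by (auto simp: N_def)
    then show ?thesis by auto
  qed
  then obtain q where q: "q < n" "g q < 0" "\<forall>i\<in>?I. x q / - g q \<le> x i / - g i"
    using finite_ex_minimum[of ?I "\<lambda>i. x i / - g i"] by auto
  define a where "a = x q / - g q"
  have aq: "a * g q = - x q" using q by (simp add: a_def)
  have yq: "- g q \<le> x q" "y q < x q" using conf[of q] q(2) P_nonneg[OF target, of q] by auto
  \<comment> \<open>Conformity gives \<open>x q + g q \<ge> y q \<ge> 0\<close>, so the full vector
    \<open>g\<close> is not yet blocked at \<open>q\<close>.\<close>
  have a1: "a \<ge> 1" unfolding a_def by (subst le_divide_eq) (use yq q(2) in simp)
  define x' where "x' = (\<lambda>j. x j + a * g j)"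
  have x'P: "x' \<in> P" unfolding x'_def
  proof (rule polyP_add_kerA[OF x(1) gk])
    fix j assume j: "j < n"
    show "0 \<le> x j + a * g j"
    proof (cases "g j < 0")
      case True
      then have "a \<le> x j / - g j" using q(3) j by (auto simp: a_def)
      then have "a * - g j \<le> x j" using True by (subst (asm) pos_le_divide_eq) auto
      then show ?thesis by simp
    next
      case False
      then have "0 \<le> a * g j" using a1 by simp
      then show ?thesis using P_nonneg[OF x(1), of j] by simp
    qed
  qed
  have Dx': "D x' = D x - a * W"
  proof -
    have "W = - (\<Sum>j\<in>N. g j)" unfolding W_def sum_negf[symmetric]
      by (intro sum.cong) (use gN in auto)
    then show ?thesis by (simp add: D_def x'_def sum.distrib sum_distrib_left)
  qed
  \<comment> \<open>The new mass \<open>D x - a * W\<close> is nonnegative while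
    \<open>D x \<le> p * W\<close>, hence \<open>a \<le> p\<close>.\<close>
  have "a * W \<le> real p * W" using Dx' D_nonneg[OF x'P] W(3) by simp
  then have ap: "a \<le> real p" using W(1) by simp
  have elem: "elementary m n A (\<lambda>j. a * g j)" using elementary_scale g(1) a1 by simp
  have maximal: "(\<lambda>j. x j + (1 + e) * (a * g j)) \<notin> P" if "e > 0" for e :: real
  proof
    assume "(\<lambda>j. x j + (1 + e) * (a * g j)) \<in> P"
    from P_nonneg[OF this, of q] have "0 \<le> - e * x q" unfolding aq by (simp add: algebra_simps)
    moreover have "e * x q > 0" using that yq q(2) by simp
    ultimately show False by simp
  qed
  have decrease: "D x' \<le> (1 - 1 / real p) * D x"
  proof -
    have "D x / real p \<le> W" using W by (simp add: divide_le_eq mult.commute)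
    also have "\<dots> \<le> a * W" using a1 W(1) by simp
    finally show ?thesis using Dx' by (simp add: algebra_simps)
  qed
  have between: "(x i \<le> x' i \<and> x' i \<le> x i + real p * (y i - x i)) \<or>
          (x' i \<le> x i \<and> x i + real p * (y i - x i) \<le> x' i)" for i
  proof (cases "g i \<ge> 0 \<and> g i \<le> y i - x i")
    case True
    then have "a * g i \<le> real p * (y i - x i)" using ap a1 by (intro mult_mono) auto
    then show ?thesis using True a1 by (auto simp: x'_def)
  next
    case False
    then have "g i \<le> 0" "y i - x i \<le> g i" using conf[of i] by auto
    then have "a * - g i \<le> real p * - (y i - x i)" using ap a1 by (intro mult_mono) auto
    moreover have "a * g i \<le> 0" using \<open>g i \<le> 0\<close> a1 by (simp add: mult_le_0_iff)
    ultimately have "x' i \<le> x i \<and> x i + real p * (y i - x i) \<le> x' i"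
      unfolding x'_def by (simp add: right_diff_distrib)
    then show ?thesis by blast
  qed
  \<comment> \<open>One factor \<open>p\<close> comes from \<open>D x \<le> p * W\<close>, the other
    from the at most \<open>p\<close> coordinates of \<open>N\<close> that carry \<open>W\<close>.
    Each entry there is at most \<open>\<kappa> * \<bar>g q\<bar>\<close>, and
    \<open>\<bar>g q\<bar> \<le> x q\<close>.\<close>
  have "D x \<le> \<kappa> * (real p)\<^sup>2 * x q"
  proof -
    have "q \<in> supp n g" using q by (auto simp: supp_def)
    note le = elementary_abs_le[OF g(1) this]
    have k0: "\<kappa> * \<bar>g q\<bar> \<ge> 0" using one_le_kappa[OF g(1)] by simp
    have "W = (\<Sum>j\<in>{j \<in> N. x j \<noteq> 0}. \<bar>g j\<bar>)" unfolding W_def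
    proof (intro sum.mono_neutral_right ballI)
      fix j assume "j \<in> N - {j \<in> N. x j \<noteq> 0}"
      then show "\<bar>g j\<bar> = 0" using conf[of j] target_N[of j] by auto
    qed auto
    also have "\<dots> \<le> (\<Sum>j\<in>{j \<in> N. x j \<noteq> 0}. \<kappa> * \<bar>g q\<bar>)" by (intro sum_mono le)
    also have "\<dots> = real (card {j \<in> N. x j \<noteq> 0}) * (\<kappa> * \<bar>g q\<bar>)" by simp
    also have "\<dots> \<le> real p * (\<kappa> * \<bar>g q\<bar>)" using p k0 by (intro mult_right_mono) auto
    also have "\<dots> \<le> real p * (\<kappa> * x q)"
      using yq q(2) one_le_kappa[OF g(1)] by (intro mult_left_mono) auto
    finally have "real p * W \<le> real p * (real p * (\<kappa> * x q))" by (intro mult_left_mono) auto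
    then show ?thesis using W(3) by (simp add: power2_eq_square algebra_simps)
  qed
  then have "\<exists>i<n. y i < x i \<and> x' i = 0 \<and> D x \<le> \<kappa> * (real p)\<^sup>2 * x i"
    using q(1) yq(2) aq by (intro exI[of _ q]) (auto simp: x'_def)
  then have "good_step p x x'"
    unfolding good_step_def using x'P decrease between elem maximal
    by (intro conjI exI[of _ "\<lambda>j. a * g j"]) (auto simp: x'_def)
  then show ?thesis by blast
qed

section \<open>Counting steps by the shrinking sets \<open>U\<close> and \<open>V\<close>\<close>

context
  fixes p :: nat
  assumes p_pos: "1 \<le> p" and kappa_ge: "1 \<le> \<kappa>"
begin

text \<open>The invariant that keeps \<open>good_step_exists\<close> applicable with the same
  \<open>p\<close> at every point of the walk.\<close>

definition low_support :: "(nat \<Rightarrow> real) \<Rightarrow> bool" where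
  "low_support x \<longleftrightarrow> x \<in> P \<and> card {j \<in> N. x j \<noteq> 0} \<le> p"

definition U :: "(nat \<Rightarrow> real) \<Rightarrow> nat set" where
  "U x = {i. i < n \<and> real p * y i < x i}"

text \<open>By \<open>dist_target_le\<close>, a point of \<open>P\<close> can be zero at a
  coordinate of \<open>supp n y\<close> only if that coordinate lies in \<open>V\<close>. A
  coordinate that has left \<open>V\<close> never blocks again.\<close>

definition V :: "(nat \<Rightarrow> real) \<Rightarrow> nat set" where
  "V x = {i \<in> supp n y. y i \<le> \<kappa> * D x}"

lemma finite_U [simp]: "finite (U x)" and finite_V [simp]: "finite (V x)"
  by (auto simp: U_def V_def)

lemma D_good_step_le:
  assumes "good_step p x x'" "x \<in> P"
  shows "D x' \<le> D x"
proof -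
  have "(1 - 1 / real p) * D x \<le> 1 * D x"
    using D_nonneg[OF assms(2)] by (intro mult_right_mono) auto
  then show ?thesis using assms(1) by (simp add: good_step_def)
qed

lemma good_step_low_support:
  assumes "good_step p x x'" "low_support x"
  shows "low_support x'"
proof -
  have between: "(x i \<le> x' i \<and> x' i \<le> x i + real p * (y i - x i)) \<or>
      (x' i \<le> x i \<and> x i + real p * (y i - x i) \<le> x' i)" for i
    using assms(1) by (simp add: good_step_def)
  have "{j \<in> N. x' j \<noteq> 0} \<subseteq> {j \<in> N. x j \<noteq> 0}"
  proof -
    have "x' j = 0" if "j \<in> N" "x j = 0" for j
      using between[of j] target_N[OF that(1)] that(2) by auto
    then show ?thesis by auto
  qed
  then have "card {j \<in> N. x' j \<noteq> 0} \<le> card {j \<in> N. x j \<noteq> 0}" by (intro card_mono) auto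
  then show ?thesis using assms by (simp add: low_support_def good_step_def)
qed

text \<open>A step that raises coordinate \<open>i\<close> ends at most at
  \<open>x i + p * (y i - x i)\<close>, which is at most \<open>p * y i\<close> because
  \<open>x i \<ge> 0\<close> and \<open>p \<ge> 1\<close>. This is why the threshold in
  \<open>U\<close> carries the factor \<open>p\<close>.\<close>

lemma U_good_step_subset:
  assumes "good_step p x x'" "x \<in> P"
  shows "U x' \<subseteq> U x"
proof
  fix i assume i: "i \<in> U x'"
  have between: "(x i \<le> x' i \<and> x' i \<le> x i + real p * (y i - x i)) \<or>
      (x' i \<le> x i \<and> x i + real p * (y i - x i) \<le> x' i)"
    using assms(1) by (simp add: good_step_def)
  have "1 * x i \<le> real p * x i" by (intro mult_right_mono P_nonneg[OF assms(2)]) (use p_pos in simp)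
  then have "x i + real p * (y i - x i) \<le> real p * y i" by (simp add: right_diff_distrib)
  then show "i \<in> U x" using i between by (auto simp: U_def)
qed

lemma V_good_step_subset:
  assumes "good_step p x x'" "x \<in> P"
  shows "V x' \<subseteq> V x"
proof -
  have "\<kappa> * D x' \<le> \<kappa> * D x"
    using D_good_step_le[OF assms] kappa_ge by (intro mult_left_mono) auto
  then show ?thesis by (auto simp: V_def)
qed

lemma good_steps_invariant:
  assumes "(good_step p ^^ k) x x'" "low_support x"
  shows "low_support x' \<and> U x' \<subseteq> U x \<and> V x' \<subseteq> V x"
  using assms
proof (induction k arbitrary: x')
  case 0
  then show ?case by simp
next
  case (Suc k)
  then obtain w where w: "(good_step p ^^ k) x w" "good_step p w x'" by auto
  with Suc have w': "low_support w \<and> U w \<subseteq> U x \<and> V w \<subseteq> V x" by simp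
  then have "w \<in> P" by (simp add: low_support_def)
  then show ?case
    using w' w(2) good_step_low_support U_good_step_subset V_good_step_subset by blast
qed

text \<open>Arriving at \<open>y\<close> early is a separate outcome, since no good step leaves
  \<open>y\<close>; hence \<open>k \<le> t\<close> instead of equality.\<close>

lemma good_steps_D_decay:
  assumes "low_support x"
  shows "\<exists>k\<le>t. \<exists>x'. (good_step p ^^ k) x x' \<and> (x' = y \<or> D x' \<le> (1 - 1 / real p) ^ t * D x)"
proof (induction t)
  case 0
  then show ?case by (intro exI[of _ 0] conjI exI[of _ x]) auto
next
  case (Suc t)
  then obtain k w where w: "k \<le> t" "(good_step p ^^ k) x w"
    "w = y \<or> D w \<le> (1 - 1 / real p) ^ t * D x" by blast
  show ?case
  proof (cases "w = y")
    case True
    then show ?thesis using w by (intro exI[of _ k]) auto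
  next
    case False
    have "low_support w" using good_steps_invariant w assms by blast
    then obtain x' where x': "good_step p w x'"
      using good_step_exists False by (auto simp: low_support_def)
    have "D x' \<le> (1 - 1 / real p) * D w" using x' by (simp add: good_step_def)
    also have "\<dots> \<le> (1 - 1 / real p) * ((1 - 1 / real p) ^ t * D x)"
      using w False p_pos by (intro mult_left_mono) auto
    finally have "D x' \<le> (1 - 1 / real p) ^ Suc t * D x" by (simp add: mult.assoc)
    moreover have "(good_step p ^^ Suc k) x x'" using w x' by auto
    ultimately show ?thesis using w(1) by (intro exI[of _ "Suc k"]) auto
  qed
qed

text \<open>Follow the coordinate \<open>i\<close> that blocks the first step. If it is in
  \<open>U x\<close>, it drops out at once. Otherwise \<open>y i\<close> is comparable to
  \<open>D x\<close>, and the decay of \<open>D\<close> over the block pushes \<open>i\<close> out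
  of \<open>V\<close>.\<close>

lemma good_steps_progress:
  assumes x: "low_support x" "x \<noteq> y"
    and T: "0 < T" "(1 - 1 / real p) ^ T * (\<kappa>\<^sup>2 * real p ^ 3) < 1"
  shows "\<exists>k\<le>T. \<exists>x'. (good_step p ^^ k) x x' \<and>
    (x' = y \<or> card (U x') + card (V x') < card (U x) + card (V x))"
proof -
  have xP: "x \<in> P" using x by (simp add: low_support_def)
  \<comment> \<open>The first step is split off because its blocking coordinate drives the argument;
    \<open>t\<close> steps of plain decay remain.\<close>
  obtain t where t: "T = Suc t" using T(1) by (cases T) auto
  obtain w where w: "good_step p x w" using good_step_exists x by (auto simp: low_support_def)
  then have wP: "w \<in> P" by (simp add: good_step_def)
  have lw: "low_support w" using good_step_low_support w x by blast
  obtain k x' where x': "k \<le> t" "(good_step p ^^ k) w x'"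
    "x' = y \<or> D x' \<le> (1 - 1 / real p) ^ t * D w" using good_steps_D_decay[OF lw] by blast
  have steps: "(good_step p ^^ Suc k) x x'" using w x'(2) by (rule relpowp_Suc_I2)
  have "card (U x') + card (V x') < card (U x) + card (V x)" if "x' \<noteq> y"
  proof -
    have sub: "U x' \<subseteq> U w" "U w \<subseteq> U x" "V x' \<subseteq> V x"
      using good_steps_invariant[OF x'(2) lw] good_steps_invariant[OF steps x(1)]
        U_good_step_subset[OF w xP] by auto
    then have le: "card (U x') \<le> card (U x)" "card (V x') \<le> card (V x)"
      by (auto intro!: card_mono)
    obtain i where i: "i < n" "y i < x i" "w i = 0" "D x \<le> \<kappa> * (real p)\<^sup>2 * x i"
      using w by (auto simp: good_step_def)
    have y0: "0 \<le> y i" by (rule P_nonneg[OF target])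
    show ?thesis
    proof (cases "i \<in> U x")
      case True
      have "i \<notin> U w" using i(3) y0 by (simp add: U_def not_less)
      then have "U x' \<subset> U x" using sub True by blast
      then have "card (U x') < card (U x)" by (simp add: psubset_card_mono)
      then show ?thesis using le by linarith
    next
      case False
      then have xi: "x i \<le> real p * y i" using i by (simp add: U_def not_less)
      have y_pos: "y i > 0" using xi y0 i(2) by (cases "y i = 0") auto
      \<comment> \<open>Since \<open>w i = 0\<close>, the distance to the target at coordinate
        \<open>i\<close> is \<open>y i\<close> itself.\<close>
      have "y i \<le> \<kappa> * D w" using dist_target_le[OF wP, of i] i(3) y0 by simp
      also have "\<dots> \<le> \<kappa> * D x"
        using D_good_step_le[OF w xP] kappa_ge by (intro mult_left_mono) auto
      finally have "i \<in> V x" using i(1) y_pos by (simp add: V_def supp_def)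
      moreover have "i \<notin> V x'"
      proof -
        let ?r = "1 - 1 / real p"
        have r: "0 \<le> ?r" using p_pos by simp
        have "D x' \<le> ?r ^ t * D w" using x'(3) that by simp
        also have "\<dots> \<le> ?r ^ t * (?r * D x)"
          using w r by (intro mult_left_mono) (auto simp: good_step_def)
        also have "\<dots> = ?r ^ T * D x" by (simp add: t algebra_simps)
        \<comment> \<open>The blocking clause is combined with \<open>x i \<le> p * y i\<close>. One
          more factor \<kappa> from the definition of \<open>V\<close> yields the \<kappa> squared
          times \<open>p\<close> cubed in the hypothesis on \<open>T\<close>.\<close>
        also have "\<dots> \<le> ?r ^ T * (\<kappa> * (real p)\<^sup>2 * (real p * y i))"
        proof (intro mult_left_mono)
          have "\<kappa> * (real p)\<^sup>2 * x i \<le> \<kappa> * (real p)\<^sup>2 * (real p * y i)"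
            using xi kappa_ge by (intro mult_left_mono) auto
          then show "D x \<le> \<kappa> * (real p)\<^sup>2 * (real p * y i)" using i(4) by linarith
        qed (use r in simp)
        finally have "\<kappa> * D x' \<le> \<kappa> * (?r ^ T * (\<kappa> * (real p)\<^sup>2 * (real p * y i)))"
          using kappa_ge by (intro mult_left_mono) auto
        also have "\<dots> = (?r ^ T * (\<kappa>\<^sup>2 * real p ^ 3)) * y i"
          by (simp add: power2_eq_square power3_eq_cube)
        also have "\<dots> < 1 * y i" using T(2) y_pos by (intro mult_strict_right_mono)
        finally show ?thesis by (simp add: V_def)
      qed
      ultimately have "V x' \<subset> V x" using sub by blast
      then have "card (V x') < card (V x)" by (simp add: psubset_card_mono)
      then show ?thesis using le by linarith
    qed
  qed
  then show ?thesis using steps x'(1) t by (intro exI[of _ "Suc k"]) auto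
qed

text \<open>Each block of at most \<open>T\<close> steps lowers
  \<open>card (U x) + card (V x)\<close> or ends at \<open>y\<close>. The additional 1 pays for the
  final block, which may reach \<open>y\<close> without lowering the sum.\<close>

lemma good_steps_reach_target:
  assumes "low_support x"
    and T: "0 < T" "(1 - 1 / real p) ^ T * (\<kappa>\<^sup>2 * real p ^ 3) < 1"
  shows "\<exists>k. k \<le> (card (U x) + card (V x) + 1) * T \<and> (good_step p ^^ k) x y"
  using assms(1)
proof (induction "card (U x) + card (V x)" arbitrary: x rule: less_induct)
  case less
  show ?case
  proof (cases "x = y")
    case True
    then show ?thesis by (intro exI[of _ 0]) auto
  next
    case False
    obtain k x' where k: "k \<le> T" "(good_step p ^^ k) x x'"
      "x' = y \<or> card (U x') + card (V x') < card (U x) + card (V x)"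
      using good_steps_progress[OF less.prems False T] by blast
    show ?thesis
    proof (cases "x' = y")
      case True
      then show ?thesis using k by (intro exI[of _ k]) (auto simp: algebra_simps)
    next
      case False
      then have lt: "card (U x') + card (V x') < card (U x) + card (V x)" using k by simp
      have "low_support x'" using good_steps_invariant k(2) less.prems by blast
      from less.hyps[OF lt this] obtain l where
        l: "l \<le> (card (U x') + card (V x') + 1) * T" "(good_step p ^^ l) x' y" by blast
      have "(card (U x') + card (V x') + 1) * T \<le> (card (U x) + card (V x)) * T"
        using lt by (intro mult_right_mono) auto
      then have "k + l \<le> (card (U x) + card (V x) + 1) * T"
        using k(1) l(1) by (simp add: algebra_simps)
      moreover have "(good_step p ^^ (k + l)) x y"
        using k(2) l(2) by (auto simp: relpowp_add)
      ultimately show ?thesis by blast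
    qed
  qed
qed

end

lemma good_steps_circuit_walk:
  assumes "(good_step p ^^ k) x x'" "x \<in> P"
  shows "\<exists>xs. circuit_walk m n A P xs \<and> hd xs = x \<and> last xs = x' \<and> length xs = Suc k"
  using assms
proof (induction k arbitrary: x')
  case 0
  then show ?case by (intro exI[of _ "[x]"]) (auto simp: circuit_walk_def)
next
  case (Suc k)
  then obtain w where w: "(good_step p ^^ k) x w" "good_step p w x'" by auto
  with Suc obtain xs where xs: "circuit_walk m n A P xs" "hd xs = x" "last xs = w"
    "length xs = Suc k" by blast
  have ne: "xs \<noteq> []" using xs(4) by auto
  then have last: "xs ! k = w" using xs last_conv_nth[of xs] by simp
  have "\<exists>g. elementary m n A g \<and> (xs @ [x']) ! Suc i = (\<lambda>j. ((xs @ [x']) ! i) j + g j) \<and>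
      (\<forall>\<epsilon>::real. \<epsilon> > 0 \<longrightarrow> (\<lambda>j. ((xs @ [x']) ! i) j + (1 + \<epsilon>) * g j) \<notin> P)"
    if i: "Suc i < length (xs @ [x'])" for i
  proof (cases "i = k")
    case True
    then show ?thesis using w(2) last xs(4) by (auto simp: good_step_def nth_append)
  next
    case False
    then have "Suc i < length xs" using i xs(4) by simp
    then show ?thesis using xs(1) by (auto simp: circuit_walk_def nth_append)
  qed
  then have "circuit_walk m n A P (xs @ [x'])"
    using xs(1) w(2) by (auto simp: circuit_walk_def good_step_def)
  then show ?case using xs ne by (intro exI[of _ "xs @ [x']"]) auto
qed

end

section \<open>The diameter bound\<close>

text \<open>More than \<open>m\<close> columns are dependent, and a nonzero kernel vector yields a
  circuit. This supplies \<open>\<kappa> \<ge> 1\<close> in the diameter bound.\<close>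

lemma ex_elementary_if_more_columns:
  assumes "m < n"
  shows "\<exists>g. elementary m n A g"
proof -
  have "\<not> indep_cols m n A {..<n}" using indep_cols_card_le[of m n A "{..<n}"] assms by auto
  then obtain z where "z \<in> kerA m n A" "z \<noteq> (\<lambda>_. 0)" by (auto simp: indep_cols_def)
  then show ?thesis using elementary_same_signs_exists by blast
qed

lemma block_length_exists:
  fixes \<kappa> :: real and p m :: nat
  assumes "1 \<le> p" "p \<le> m" "1 \<le> \<kappa>"
  obtains T :: nat where "0 < T" "(1 - 1 / real p) ^ T * (\<kappa>\<^sup>2 * real p ^ 3) < 1"
    "real T \<le> 7 * real p * ln (real m + \<kappa>)"
proof -
  define l where "l = ln (real m + \<kappa>)"
  \<comment> \<open>From \<open>m + \<kappa> \<ge> 2\<close> one gets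
    \<open>p * l \<ge> 1/2\<close>, so rounding up costs at most \<open>2 * p * l\<close>; this
    turns the factor 5 into 7.\<close>
  have "ln 2 \<le> l" unfolding l_def using assms by (subst ln_le_cancel_iff) auto
  moreover have "(1/2::real) \<le> ln 2" using ln_2_less_1 ln2_ge_two_thirds by linarith
  ultimately have l: "1/2 \<le> l" by linarith
  then have pl: "1/2 \<le> real p * l" using mult_mono[of 1 "real p" "1/2" l] assms by simp
  \<comment> \<open>The factor 5 is the sum of the exponents 2 of \<kappa> and 3 of
    \<open>p\<close>: the power of \<open>1 - 1 / p\<close> is at most \<open>exp (- 5 * l)\<close>,
    and both \<open>ln \<kappa>\<close> and \<open>ln p\<close> are strictly below
    \<open>l\<close>.\<close>
  define T where "T = nat \<lceil>5 * real p * l\<rceil>"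
  have T: "5 * real p * l \<le> real T" "real T \<le> 5 * real p * l + 1"
    unfolding T_def using pl by linarith+
  have "T > 0" using T(1) pl by (cases "T = 0") (simp_all add: ac_simps)
  have lt: "ln \<kappa> < l" "ln (real p) < l"
    unfolding l_def using assms by (auto simp: ln_less_cancel_iff)
  have "(1 - 1 / real p) ^ T \<le> exp (- (1 / real p)) ^ T"
    using assms exp_ge_add_one_self[of "- (1 / real p)"] by (intro power_mono) auto
  also have "\<dots> = exp (- (real T / real p))" by (simp flip: exp_of_nat_mult)
  also have "\<dots> \<le> exp (- (5 * l))" using T(1) assms by (simp add: field_simps)
  finally have "(1 - 1 / real p) ^ T * (\<kappa>\<^sup>2 * real p ^ 3) \<le> exp (- (5 * l)) * (\<kappa>\<^sup>2 * real p ^ 3)"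
    by (intro mult_right_mono) auto
  also have "\<dots> = exp (- (5 * l)) * exp (2 * ln \<kappa> + 3 * ln (real p))"
  proof -
    have "exp (2 * ln \<kappa>) = \<kappa>\<^sup>2" "exp (3 * ln (real p)) = real p ^ 3"
      using assms exp_of_nat_mult[of 2 "ln \<kappa>"] exp_of_nat_mult[of 3 "ln (real p)"] by simp_all
    then show ?thesis by (simp add: exp_add)
  qed
  also have "\<dots> = exp (2 * ln \<kappa> + 3 * ln (real p) - 5 * l)"
    by (simp flip: exp_add)
  also have "\<dots> < 1" using lt by simp
  finally have "(1 - 1 / real p) ^ T * (\<kappa>\<^sup>2 * real p ^ 3) < 1" .
  moreover have "real T \<le> 7 * real p * l" using T(2) pl by linarith
  ultimately show ?thesis using that[of T] \<open>T > 0\<close> by (simp add: l_def)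
qed

text \<open>The constant is 21 = 3 * 7: at most \<open>3 * m\<close> blocks, each of length at most
  \<open>7 * p * ln (m + \<kappa>)\<close>. Full row rank enters through the choice of the basis
  \<open>B\<close>.\<close>

lemma circuit_walk_between_vertices:
  assumes "full_row_rank m n A" "vertex (polyP m n A b) x" "vertex (polyP m n A b) y"
  shows "\<exists>xs. circuit_walk m n A (polyP m n A b) xs \<and> hd xs = x \<and> last xs = y \<and>
    real (length xs - 1) \<le> 21 * real m * real (min m (n - m)) * ln (real m + kappa m n A)"
proof -
  have xP: "x \<in> polyP m n A b" and yP: "y \<in> polyP m n A b" using assms by (auto simp: vertex_def)
  obtain B where B: "indep_cols m n A B" "supp n y \<subseteq> B" "card B = m"
    using basis_extension[OF assms(1) vertex_indep_supp[OF assms(3)]] .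
  interpret basic_target m n A b y B by unfold_locales (use yP B in auto)
  have Bn: "B \<subseteq> {..<n}" using B(1) by (simp add: indep_cols_def)
  then have fB: "finite B" and mn: "m \<le> n"
    using B(3) finite_subset card_mono[OF _ Bn] by auto
  define p where "p = min m (n - m)"
  have suppx: "card (supp n x) \<le> m" by (rule indep_cols_card_le[OF vertex_indep_supp[OF assms(2)]])
  have cN: "card N = n - m" using card_Diff_subset[OF fB Bn] B(3) by (simp add: N_def)
  \<comment> \<open>The vertex \<open>x\<close> has at most \<open>m\<close> nonzero coordinates,
    and \<open>N\<close> has \<open>n - m\<close> elements.\<close>
  have sN: "card {j \<in> N. x j \<noteq> 0} \<le> p"
  proof -
    have "card {j \<in> N. x j \<noteq> 0} \<le> card (supp n x)"
      by (rule card_mono) (auto simp: supp_def N_def)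
    moreover have "card {j \<in> N. x j \<noteq> 0} \<le> card N" by (rule card_mono) auto
    ultimately show ?thesis using suppx cN by (simp add: p_def)
  qed
  show ?thesis
  \<comment> \<open>For \<open>p = 0\<close> the claimed bound is zero, so the walk has to be the
    single point \<open>x = y\<close>.\<close>
  proof (cases "p = 0")
    case True
    then have "{j \<in> N. x j \<noteq> 0} = {}" using sN by (simp add: card_eq_0_iff)
    then have "x = y" using D_zero_imp_target[OF xP] by blast
    then show ?thesis
      using xP True by (intro exI[of _ "[x]"]) (auto simp: circuit_walk_def p_def)
  next
    case False
    then have p1: "1 \<le> p" and pm: "p \<le> m" and "m < n" by (auto simp: p_def)
    then have k1: "1 \<le> \<kappa>" using ex_elementary_if_more_columns one_le_kappa by blast
    obtain T :: nat where T: "0 < T" "(1 - 1 / real p) ^ T * (\<kappa>\<^sup>2 * real p ^ 3) < 1"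
      "real T \<le> 7 * real p * ln (real m + \<kappa>)" using block_length_exists[OF p1 pm k1] .
    have low: "low_support p x" using xP sN by (simp add: low_support_def[OF p1 k1])
    obtain k where k: "k \<le> (card (U p x) + card (V x) + 1) * T" "(good_step p ^^ k) x y"
      using good_steps_reach_target[OF p1 k1 low T(1,2)] by blast
    have "U p x \<subseteq> supp n x"
    proof
      fix i assume "i \<in> U p x"
      then have "i < n" "real p * y i < x i" by (auto simp: U_def[OF p1 k1])
      moreover have "0 \<le> real p * y i" using P_nonneg[OF yP] by simp
      ultimately show "i \<in> supp n x" by (auto simp: supp_def)
    qed
    then have "card (U p x) \<le> m" using suppx card_mono[OF finite_supp] le_trans by blast
    moreover have "card (V x) \<le> m"
      using card_mono[OF fB, of "V x"] B by (auto simp: V_def[OF p1 k1])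
    \<comment> \<open>The sets \<open>U\<close> and \<open>V\<close> contribute \<open>m\<close>
      each, and the last block is absorbed by \<open>1 \<le> p \<le> m\<close>.\<close>
    ultimately have "card (U p x) + card (V x) + 1 \<le> 3 * m" using p1 pm by linarith
    then have "(card (U p x) + card (V x) + 1) * T \<le> (3 * m) * T" by (rule mult_right_mono) simp
    with k(1) have "k \<le> (3 * m) * T" by (rule le_trans)
    then have "real k \<le> real ((3 * m) * T)" by (simp only: of_nat_le_iff)
    also have "\<dots> = 3 * real m * real T" by simp
    also have "\<dots> \<le> 3 * real m * (7 * real p * ln (real m + \<kappa>))"
      using T(3) by (intro mult_left_mono) auto
    also have "\<dots> = 21 * real m * real p * ln (real m + \<kappa>)" by simp
    finally have "real k \<le> 21 * real m * real p * ln (real m + \<kappa>)" .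
    then show ?thesis using good_steps_circuit_walk[OF k(2) xP] by (auto simp: p_def)
  qed
qed

theorem theorem1p1:
  shows "\<exists>C::real. C > 0 \<and>
    (\<forall>(m::nat) (n::nat) (A::nat \<Rightarrow> nat \<Rightarrow> real) (b::nat \<Rightarrow> real).
       full_row_rank m n A \<longrightarrow>
       (\<forall>x y. vertex (polyP m n A b) x \<and> vertex (polyP m n A b) y \<longrightarrow>
          (\<exists>xs. circuit_walk m n A (polyP m n A b) xs \<and> hd xs = x \<and> last xs = y \<and>
                real (length xs - 1) \<le> C * real m * real (min m (n - m)) * ln (real m + kappa m n A))))"
  using circuit_walk_between_vertices by (intro exI[of _ 21] conjI) (simp, blast)

end
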